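(* Let $t$ be a positive integer and $n$ an integer with $1<n<\frac{15+\sqrt{33}}{24}t^2$. If $M$ is an $n\times n$ $t$-disjunct matrix, then $M$ is a permutation matrix. Equivalently, if $\mathcal F\subseteq2^{[n]}$ is a $t$-cover-free family of size $n$, then $\mathcal F=\{\{1\},\{2\},\dots,\{n\}\}$.
   Context: A family $\mathcal F\subseteq2^{[n]}$ is $t$-cover-free if $A_0\not\subseteq A_1\cup\dots\cup A_r$ for all distinct $A_0,\dots,A_r\in\mathcal F$ with $r\le t$. The incidence matrix of $\mathcal F=\{F_1,\dots,F_w\}$ is the $n\times w$ $0/1$ matrix $M$ with $M(u,v)=1$ iff $u\in F_v$. A binary matrix is $t$-disjunct if it is the incidence matrix of a $t$-cover-free family; equivalently, its columns are distinct and for every $j\le t$ the Boolean sum of any $j$ columns does not contain any other column. *)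

theory Defs
  imports Complex_Main "Jordan_Normal_Form.Matrix"
begin

text \<open>The number \<open>r\<close> of covering sets is taken to be at least 1. Allowing \<open>r = 0\<close> would only
  add that the empty set is not in the family, which follows from the case \<open>r = 1\<close> as soon as
  \<open>t \<ge> 1\<close> and the family has at least two members.\<close>

definition cover_free :: "nat \<Rightarrow> 'a set set \<Rightarrow> bool" where
  "cover_free t \<F> \<longleftrightarrow>
     (\<forall>r \<in> {1..t}. \<forall>A :: nat \<Rightarrow> 'a set.
        inj_on A {0..r} \<and> A ` {0..r} \<subseteq> \<F> \<longrightarrow> \<not> A 0 \<subseteq> (\<Union>i\<in>{1..r}. A i))"

text \<open>The ground set is \<open>{1..n}\<close> and families are enumerated as \<open>F 1, \<dots>, F w\<close>, whereas the indices of
  type \<open>mat\<close> start at 0; hence the shift by \<open>Suc\<close>.\<close>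

definition incidence_mat :: "nat \<Rightarrow> nat \<Rightarrow> (nat \<Rightarrow> nat set) \<Rightarrow> int mat" where
  "incidence_mat n w F = mat n w (\<lambda>(u, v). if Suc u \<in> F (Suc v) then 1 else 0)"

definition disjunct_mat :: "nat \<Rightarrow> int mat \<Rightarrow> bool" where
  "disjunct_mat t M \<longleftrightarrow>
     (\<exists>F. inj_on F {1..dim_col M} \<and> F ` {1..dim_col M} \<subseteq> Pow {1..dim_row M} \<and>
          cover_free t (F ` {1..dim_col M}) \<and>
          M = incidence_mat (dim_row M) (dim_col M) F)"

definition permutation_mat :: "int mat \<Rightarrow> bool" where
  "permutation_mat M \<longleftrightarrow>
     square_mat M \<and>
     (\<forall>i < dim_row M. \<forall>j < dim_col M. M $$ (i, j) \<in> {0, 1}) \<and>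
     (\<forall>i < dim_row M. \<exists>!j. j < dim_col M \<and> M $$ (i, j) = 1) \<and>
     (\<forall>j < dim_col M. \<exists>!i. i < dim_row M \<and> M $$ (i, j) = 1)"

end

theory Submission
  imports Defs
begin

text \<open>Let \<open>c = (15 + sqrt 33) / 24\<close> and argue by induction on \<open>t\<close>. A set with a point of its own can
  be discarded together with that point, so suppose that no set has an own point. If some set \<open>A\<close>
  has at least \<open>2 c t - c\<close> points, then removing \<open>A\<close> from the family and its points from all other
  sets leaves a \<open>(t - 1)\<close>-cover-free family with more sets than points on fewer than
  \<open>c (t - 1)\<^sup>2\<close> points, contrary to the induction hypothesis. Otherwise all sets are small.
  A matching of size \<open>k\<close> among the pairs of \<open>A\<close> that lie in another set gives a cover of \<open>A\<close>
  by \<open>|A| - k\<close> other sets, so \<open>k < |A| - t\<close>, and the Erdos--Gallai bound on the number of edges of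
  a graph with small matching number shows that \<open>A\<close> has at least \<open>(c t\<^sup>2 - 1) / 2\<close> pairs of its own.
  Own pairs of different sets are different, so there are too many of them. The constant \<open>c\<close>
  is the root of \<open>12 c\<^sup>2 - 15 c + 4 = 0\<close> at which the two cases balance.\<close>

section \<open>The Erdos--Gallai bound by shifting\<close>

text \<open>The compression operator of extremal set theory. The test against \<open>E\<close>
  leaves an edge alone when its image is already taken, which keeps the number of edges.\<close>

definition shift_edge :: "'a \<Rightarrow> 'a \<Rightarrow> 'a set set \<Rightarrow> 'a set \<Rightarrow> 'a set" where
  "shift_edge i j E e =
     (if j \<in> e \<and> i \<notin> e \<and> insert i (e - {j}) \<notin> E then insert i (e - {j}) else e)"

text \<open>Moved edges land outside \<open>E\<close> and the others stay inside, so only two moved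
  edges could collide; but a move can be undone by swapping \<open>i\<close> back for
  \<open>j\<close>.\<close>

lemma inj_on_shift_edge: "inj_on (shift_edge i j E) E"
proof (rule inj_onI)
  fix e f assume ef: "e \<in> E" "f \<in> E" and eq: "shift_edge i j E e = shift_edge i j E f"
  show "e = f"
  proof (cases "j \<in> e \<and> i \<notin> e \<and> insert i (e - {j}) \<notin> E")
    case e: True
    show ?thesis
    proof (cases "j \<in> f \<and> i \<notin> f \<and> insert i (f - {j}) \<notin> E")
      case True
      with e eq have "insert i (e - {j}) = insert i (f - {j})"
        by (simp add: shift_edge_def)
      then have "insert j (insert i (e - {j}) - {i}) = insert j (insert i (f - {j}) - {i})"
        by simp
      moreover have "insert j (insert i (g - {j}) - {i}) = g" if "j \<in> g" "i \<notin> g" for g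
        using that by auto
      ultimately show ?thesis using e True by auto
    next
      case False
      with e eq ef show ?thesis by (auto simp: shift_edge_def)
    qed
  next
    case False
    with eq ef show ?thesis by (auto simp: shift_edge_def split: if_splits)
  qed
qed

lemma card_insert_remove_eq:
  assumes "finite e" "j \<in> e" "i \<notin> e"
  shows "card (insert i (e - {j})) = card e"
  using assms by (metis Diff_iff card_Suc_Diff1 card_insert_disjoint finite_Diff)

lemma card_shift_edge: "finite e \<Longrightarrow> card (shift_edge i j E e) = card e"
  by (simp add: shift_edge_def card_insert_remove_eq
      del: card_insert_disjoint card_Diff_singleton)

text \<open>Every moved edge contains \<open>i\<close>, so a matching holds at most one edge
  \<open>f\<close> outside \<open>E\<close>, and \<open>f\<close> can be traded for its preimage
  \<open>e\<close>. This fails only if some other \<open>g\<close> of the matching contains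
  \<open>j\<close>; then \<open>g\<close> is also traded, for \<open>g\<close> with \<open>j\<close>
  replaced by \<open>i\<close>.\<close>

lemma matching_of_shift_edge:
  assumes M: "M \<subseteq> shift_edge i j E ` E" "pairwise disjnt M" "finite M" and "i \<noteq> j"
  shows "\<exists>M'\<subseteq>E. card M' = card M \<and> pairwise disjnt M'"
proof (cases "M \<subseteq> E")
  case True
  with M show ?thesis by blast
next
  case False
  then obtain f where f: "f \<in> M" "f \<notin> E" by blast
  then obtain e where e: "e \<in> E" "f = shift_edge i j E e" using M by blast
  with f have fe: "f = insert i (e - {j})" "j \<in> e" "i \<notin> e"
    by (auto simp: shift_edge_def split: if_splits)
  define N where "N = M - {f}"
  have Nf: "disjnt h f" if "h \<in> N" for h
    using that M f by (auto simp: N_def pairwise_def)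
  have Ni: "i \<notin> h" if "h \<in> N" for h
    using Nf[OF that] fe by (auto simp: disjnt_def)
  have NE: "N \<subseteq> E"
  proof
    fix h assume h: "h \<in> N"
    with M obtain k where "k \<in> E" "h = shift_edge i j E k" by (auto simp: N_def)
    with Ni[OF h] show "h \<in> E" by (auto simp: shift_edge_def split: if_splits)
  qed
  have Nd: "pairwise disjnt N" using M by (auto simp: N_def pairwise_def)
  have finN: "finite N" and cM: "card M = Suc (card N)"
    using M f card.remove[of M f] by (simp_all only: N_def finite_Diff)
  have dis: "disjnt e h \<and> disjnt h e" if "h \<in> N" "j \<notin> h" for h
    using Nf[OF that(1)] that fe by (auto simp: disjnt_def)
  show ?thesis
  proof (cases "\<exists>g\<in>N. j \<in> g")
    case False
    have "e \<notin> N" using False fe by blast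
    moreover have "pairwise disjnt (insert e N)"
      using Nd dis False by (auto simp: pairwise_insert)
    ultimately show ?thesis using NE e finN cM by (intro exI[of _ "insert e N"]) auto
  next
    case True
    then obtain g where g: "g \<in> N" "j \<in> g" by blast
    define g' where "g' = insert i (g - {j})"
    define L where "L = N - {g}"
    have gi: "i \<notin> g" using Ni g by blast
    \<comment> \<open>The edge \<open>g\<close> avoids \<open>i\<close> and so is its own preimage.
      It contains \<open>j\<close> and yet was not moved, which means that its image was already in
      \<open>E\<close>.\<close>
    have g'E: "g' \<in> E"
    proof -
      from g M obtain k where k: "k \<in> E" "g = shift_edge i j E k" by (auto simp: N_def)
      with gi have "k = g" by (auto simp: shift_edge_def split: if_splits)
      with k(2) have "shift_edge i j E g = g" by metis
      with gi g show ?thesis unfolding shift_edge_def g'_def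
        by (metis insertI1)
    qed
    have Lg: "disjnt h g" if "h \<in> L" for h
      using that Nd g by (auto simp: L_def pairwise_def)
    have Lj: "j \<notin> h" if "h \<in> L" for h
      using Lg[OF that] g by (auto simp: disjnt_def)
    have Lg': "disjnt h g' \<and> disjnt g' h" if "h \<in> L" for h
      using Lg[OF that] Ni[of h] that by (auto simp: disjnt_def g'_def L_def)
    have Le: "disjnt h e \<and> disjnt e h" if "h \<in> L" for h
      using dis[of h] Lj[OF that] that by (auto simp: L_def)
    have eg': "disjnt e g' \<and> disjnt g' e"
      using Nf[OF g(1)] fe \<open>i \<noteq> j\<close> by (auto simp: disjnt_def g'_def)
    have "e \<notin> L" using Lj fe by blast
    moreover have "g' \<notin> L" using Ni by (auto simp: L_def g'_def)
    moreover have "e \<noteq> g'" using fe \<open>i \<noteq> j\<close> by (auto simp: g'_def)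
    moreover have "card N = Suc (card L)" "finite L"
      using finN g card.remove[of N g] by (simp_all only: L_def finite_Diff)
    moreover have "pairwise disjnt (insert e (insert g' L))"
    proof -
      have "pairwise disjnt L" using Nd by (auto simp: L_def pairwise_def)
      then show ?thesis using Lg' Le eg' by (auto simp: pairwise_insert)
    qed
    moreover have "insert e (insert g' L) \<subseteq> E" using NE e g'E by (auto simp: L_def)
    ultimately show ?thesis using cM by (intro exI[of _ "insert e (insert g' L)"]) auto
  qed
qed

definition shift_stable :: "nat set set \<Rightarrow> bool" where
  "shift_stable E \<longleftrightarrow>
     (\<forall>e\<in>E. \<forall>j\<in>e. \<forall>i<j. i \<notin> e \<longrightarrow> insert i (e - {j}) \<in> E)"

definition matching_free :: "nat \<Rightarrow> 'a set set \<Rightarrow> bool" where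
  "matching_free k E \<longleftrightarrow> \<not> (\<exists>M\<subseteq>E. card M = k \<and> pairwise disjnt M)"

text \<open>Shifting keeps the number of edges and creates no larger matching. A shift with
  \<open>i < j\<close> that changes \<open>E\<close> lowers the sum of all vertex labels over all
  edges, so the process ends.\<close>

lemma ex_shift_stable:
  assumes "E \<subseteq> {e. e \<subseteq> {..<n::nat} \<and> card e = 2}" "matching_free k E" "k > 0"
  shows "\<exists>E'. E' \<subseteq> {e. e \<subseteq> {..<n} \<and> card e = 2} \<and> matching_free k E' \<and>
           card E' = card E \<and> shift_stable E'"
  using assms(1,2)
proof (induction "\<Sum>e\<in>E. \<Sum>e" arbitrary: E rule: less_induct)
  case less
  show ?case
  proof (cases "shift_stable E")
    case True
    with less.prems show ?thesis by blast
  next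
    case False
    then obtain e i j where e: "e \<in> E" "j \<in> e" "i < j" "i \<notin> e" "insert i (e - {j}) \<notin> E"
      unfolding shift_stable_def by blast
    define s where "s = shift_edge i j E"
    have finE: "finite E"
      by (rule finite_subset[OF less.prems(1)]) (simp add: finite_subset)
    have fin: "finite f" if "f \<in> E" for f
      using that less.prems(1) by (auto intro: finite_subset)
    have lt: "\<Sum>(insert i (f - {j})) < \<Sum>f" if "f \<in> E" "j \<in> f" "i \<notin> f" for f
      using that fin[OF that(1)] e by (simp add: sum.remove[of f j])
    have le: "\<Sum>(s f) \<le> \<Sum>f" if "f \<in> E" for f
      using lt[OF that] by (auto simp: s_def shift_edge_def intro: less_imp_le)
    have "(\<Sum>e\<in>s ` E. \<Sum>e) = (\<Sum>e\<in>E. \<Sum>(s e))"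
      unfolding s_def by (simp add: sum.reindex[OF inj_on_shift_edge] o_def)
    also have "\<dots> < (\<Sum>e\<in>E. \<Sum>e)"
    proof (rule sum_strict_mono_ex1[OF finE])
      show "\<forall>f\<in>E. \<Sum>(s f) \<le> \<Sum>f" using le by blast
      show "\<exists>f\<in>E. \<Sum>(s f) < \<Sum>f"
        using e lt[of e] by (intro bexI[of _ e]) (auto simp: s_def shift_edge_def)
    qed
    finally have dec: "(\<Sum>e\<in>s ` E. \<Sum>e) < (\<Sum>e\<in>E. \<Sum>e)" .
    have sub: "s ` E \<subseteq> {e. e \<subseteq> {..<n} \<and> card e = 2}"
    proof clarify
      fix f assume f: "f \<in> E"
      have "s f \<subseteq> insert i f" by (auto simp: s_def shift_edge_def)
      moreover have "i < n" using e less.prems(1) by fastforce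
      ultimately show "s f \<subseteq> {..<n} \<and> card (s f) = 2"
        using f fin[OF f] less.prems(1) by (auto simp: s_def card_shift_edge)
    qed
    have mf: "matching_free k (s ` E)"
      unfolding matching_free_def
    proof
      assume "\<exists>M\<subseteq>s ` E. card M = k \<and> pairwise disjnt M"
      then obtain M where M: "M \<subseteq> s ` E" "card M = k" "pairwise disjnt M" by blast
      then have "finite M" using \<open>k > 0\<close> card_ge_0_finite by blast
      with M obtain M' where "M' \<subseteq> E" "card M' = k" "pairwise disjnt M'"
        using matching_of_shift_edge[of M i j E] e unfolding s_def by auto
      with less.prems(2) show False by (auto simp: matching_free_def)
    qed
    have "card (s ` E) = card E"
      by (simp add: s_def card_image inj_on_shift_edge)
    with less.hyps[OF dec sub mf] show ?thesis by simp
  qed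
qed

text \<open>The smaller endpoint is lowered first: \<open>p \<le> x < y\<close> and
  \<open>p < q\<close> then ensure that the endpoints never collide.\<close>

lemma shift_stable_edge:
  assumes "shift_stable E" "{x, y} \<in> E" "x < y" "p \<le> x" "q \<le> y" "p < q"
  shows "{p, q} \<in> E"
proof -
  have "{p, y} \<in> E"
  proof (cases "p = x")
    case False
    then have "insert p ({x, y} - {x}) \<in> E"
      using assms unfolding shift_stable_def by auto
    moreover have "insert p ({x, y} - {x}) = {p, y}" using assms by auto
    ultimately show ?thesis by simp
  qed (use assms in auto)
  show ?thesis
  proof (cases "q = y")
    case False
    then have "insert q ({p, y} - {y}) \<in> E"
      using assms \<open>{p, y} \<in> E\<close> unfolding shift_stable_def by auto
    moreover have "insert q ({p, y} - {y}) = {p, q}" using assms by auto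
    ultimately show ?thesis by simp
  qed (use \<open>{p, y} \<in> E\<close> in auto)
qed

lemma matching_free_missing_edge:
  assumes "matching_free (Suc k) E"
  shows "\<exists>p\<le>k. {p, 2 * k + 1 - p} \<notin> E"
proof (rule ccontr)
  assume neg: "\<not> ?thesis"
  \<comment> \<open>Otherwise these nested edges form a perfect matching of the first \<open>2 * k + 2\<close> vertices.\<close>
  define m where "m p = {p, 2 * k + 1 - p}" for p
  have sub: "m ` {..k} \<subseteq> E" using neg by (auto simp: m_def)
  have dis: "disjnt (m p) (m q)" if "p \<le> k" "q \<le> k" "p \<noteq> q" for p q
    using that by (auto simp: m_def disjnt_def)
  have "inj_on m {..k}"
  proof (rule inj_onI)
    fix p q assume "p \<in> {..k}" "q \<in> {..k}" "m p = m q"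
    then show "p = q" using dis[of p q] by (auto simp: disjnt_def m_def)
  qed
  then have "card (m ` {..k}) = Suc k" by (simp add: card_image)
  moreover have "pairwise disjnt (m ` {..k})"
    using dis by (fastforce simp: pairwise_def)
  ultimately show False using assms sub by (auto simp: matching_free_def)
qed

text \<open>After shifting, a missing edge \<open>{p, q}\<close> with
  \<open>p + q = 2 * k + 1\<close> rules out every edge above it, so each edge meets
  \<open>{..<p}\<close> or lies inside \<open>{p..<q}\<close>. Counting these pairs gives the bound
  with \<open>r = k - p\<close>. The values \<open>r = 0\<close> and \<open>r = k\<close> belong to
  the two extremal graphs of Erdos and Gallai; the maximum over \<open>r\<close> is left for
  later.\<close>

lemma erdos_gallai_nat:
  assumes E: "E \<subseteq> {e. e \<subseteq> {..<n::nat} \<and> card e = 2}" and mf: "matching_free (Suc k) E"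
    and n: "2 * k + 2 \<le> n"
  shows "\<exists>r\<le>k. card E + ((n - k + r) choose 2) \<le> (n choose 2) + ((2 * r + 1) choose 2)"
proof -
  obtain E' where E': "E' \<subseteq> {e. e \<subseteq> {..<n} \<and> card e = 2}" "matching_free (Suc k) E'"
      "card E' = card E" "shift_stable E'"
    using ex_shift_stable[OF E mf] by blast
  obtain p where p: "p \<le> k" "{p, 2 * k + 1 - p} \<notin> E'"
    using matching_free_missing_edge[OF E'(2)] by blast
  define q where "q = 2 * k + 1 - p"
  have pq: "p < q" "q < n" "q - p = 2 * (k - p) + 1" using p n by (auto simp: q_def)
  let ?P = "\<lambda>V. {e. e \<subseteq> V \<and> card e = (2::nat)}"
  have card_P: "card (?P V) = card V choose 2" and finite_P: "finite (?P V)"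
    if "finite V" for V :: "nat set"
    using that by (simp_all add: n_subsets)
  have "E' \<subseteq> (?P {..<n} - ?P {p..<n}) \<union> ?P {p..<q}"
  proof
    fix e assume e: "e \<in> E'"
    with E' have en: "e \<subseteq> {..<n}" "card e = 2" by auto
    then obtain x y where xy: "e = {x, y}" "x < y"
      by (metis card_2_iff insert_commute linorder_neqE_nat)
    have "\<not> (p \<le> x \<and> q \<le> y)"
      using shift_stable_edge[OF E'(4), of x y p q] xy e p pq by (auto simp: q_def)
    then show "e \<in> (?P {..<n} - ?P {p..<n}) \<union> ?P {p..<q}"
      using en xy by auto
  qed
  then have "card E' \<le> card ((?P {..<n} - ?P {p..<n}) \<union> ?P {p..<q})"
    by (intro card_mono) (simp_all add: finite_P)
  also have "\<dots> \<le> card (?P {..<n} - ?P {p..<n}) + card (?P {p..<q})"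
    by (rule card_Un_le)
  also have "card (?P {..<n} - ?P {p..<n}) = card (?P {..<n}) - card (?P {p..<n})"
    by (intro card_Diff_subset) (auto simp: finite_P)
  finally have "card E \<le> (n choose 2) - ((n - p) choose 2) + ((2 * (k - p) + 1) choose 2)"
    using E'(3) pq by (simp add: card_P)
  moreover have "((n - p) choose 2) \<le> (n choose 2)"
    by (intro binomial_right_mono) simp
  moreover have "n - k + (k - p) = n - p" using p n by simp
  ultimately show ?thesis by (intro exI[of _ "k - p"]) auto
qed

lemma erdos_gallai:
  assumes V: "finite V" and E: "E \<subseteq> {e. e \<subseteq> V \<and> card e = 2}"
    and mf: "matching_free (Suc k) E" and n: "2 * k + 2 \<le> card V"
  shows "\<exists>r\<le>k. card E + ((card V - k + r) choose 2) \<le>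
           (card V choose 2) + ((2 * r + 1) choose 2)"
proof -
  obtain h where h: "bij_betw h V {..<card V}"
    using ex_bij_betw_finite_nat[OF V] by (auto simp: atLeast0LessThan)
  then have inj: "inj_on h V" by (rule bij_betw_imp_inj_on)
  have injP: "inj_on ((`) h) (Pow V)" using inj by (rule inj_on_image_Pow)
  have EP: "E \<subseteq> Pow V" using E by auto
  have sub: "(`) h ` E \<subseteq> {e. e \<subseteq> {..<card V} \<and> card e = 2}"
  proof clarify
    fix e assume "e \<in> E"
    then have e: "e \<subseteq> V" "card e = 2" using E by auto
    then have "h ` e \<subseteq> {..<card V}" using h by (auto simp: bij_betw_def)
    moreover have "card (h ` e) = 2"
      using e card_image[OF inj_on_subset[OF inj e(1)]] by simp
    ultimately show "h ` e \<subseteq> {..<card V} \<and> card (h ` e) = 2" by blast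
  qed
  have "matching_free (Suc k) ((`) h ` E)"
    unfolding matching_free_def
  proof
    assume "\<exists>M\<subseteq>(`) h ` E. card M = Suc k \<and> pairwise disjnt M"
    then obtain M where M: "M \<subseteq> (`) h ` E" "card M = Suc k" "pairwise disjnt M" by blast
    then obtain N where N: "N \<subseteq> E" "M = (`) h ` N" by (auto simp: subset_image_iff)
    have injN: "inj_on ((`) h) N" using injP EP N by (auto intro: inj_on_subset)
    have "card N = Suc k" using M N card_image[OF injN] by simp
    moreover have "pairwise disjnt N"
    proof (rule pairwiseI)
      fix a b assume ab: "a \<in> N" "b \<in> N" "a \<noteq> b"
      then have "h ` a \<noteq> h ` b" using injN by (auto dest: inj_onD)
      then have "disjnt (h ` a) (h ` b)" using M(3) N ab by (auto simp: pairwise_def)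
      then show "disjnt a b" by (auto simp: disjnt_def)
    qed
    ultimately show False using mf N by (auto simp: matching_free_def)
  qed
  from erdos_gallai_nat[OF sub this n] show ?thesis
    using card_image[OF inj_on_subset[OF injP EP]] by simp
qed

section \<open>Own pairs\<close>

text \<open>The empty \<open>G\<close> is allowed, so the empty set is not a member of \<open>F\<close>.\<close>

definition no_small_cover :: "nat \<Rightarrow> 'a set set \<Rightarrow> bool" where
  "no_small_cover t F \<longleftrightarrow>
     (\<forall>A\<in>F. \<forall>G\<subseteq>F - {A}. finite G \<longrightarrow> card G \<le> t \<longrightarrow> \<not> A \<subseteq> \<Union>G)"

definition no_own_point :: "'a set set \<Rightarrow> bool" where
  "no_own_point F \<longleftrightarrow> (\<forall>A\<in>F. \<forall>x\<in>A. \<exists>B\<in>F - {A}. x \<in> B)"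

definition own_pairs :: "'a set set \<Rightarrow> 'a set \<Rightarrow> 'a set set" where
  "own_pairs F A = {e. e \<subseteq> A \<and> card e = 2 \<and> (\<forall>B\<in>F - {A}. \<not> e \<subseteq> B)}"

lemma no_small_coverD:
  assumes "no_small_cover t F" "A \<in> F" "G \<subseteq> F - {A}" "finite G" "A \<subseteq> \<Union>G"
  shows "t < card G"
  using assms unfolding no_small_cover_def by (meson not_le)

lemma no_small_cover_subset: "no_small_cover t F \<Longrightarrow> F' \<subseteq> F \<Longrightarrow> no_small_cover t F'"
  unfolding no_small_cover_def by (meson Diff_mono order_refl subsetD subset_trans)

lemma no_small_cover_nonempty: "no_small_cover t F \<Longrightarrow> {} \<notin> F"
  using no_small_coverD[of t F "{}" "{}"] by auto

text \<open>One other set for each pair in \<open>M\<close> and one for each of the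
  \<open>card A - 2 * card M\<close> points left over cover \<open>A\<close>, and a cover needs more
  than \<open>t\<close> sets.\<close>

lemma matching_size_bound:
  assumes F: "no_small_cover t F" "no_own_point F" "A \<in> F" "finite A"
    and M: "finite M" "pairwise disjnt M"
    and ME: "\<And>e. e \<in> M \<Longrightarrow> e \<subseteq> A \<and> card e = 2 \<and> (\<exists>B\<in>F - {A}. e \<subseteq> B)"
  shows "card M + t < card A"
proof -
  obtain b where b: "\<And>e. e \<in> M \<Longrightarrow> b e \<in> F - {A} \<and> e \<subseteq> b e"
    using ME by metis
  obtain g where g: "\<And>x. x \<in> A \<Longrightarrow> g x \<in> F - {A} \<and> x \<in> g x"
    using F unfolding no_own_point_def by metis
  define G where "G = b ` M \<union> g ` (A - \<Union>M)"
  have UA: "\<Union>M \<subseteq> A" using ME by blast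
  have "card (\<Union>M) = (\<Sum>e\<in>M. card e)"
    using M ME F(4) by (intro card_Union_disjoint) (auto intro: finite_subset)
  also have "\<dots> = 2 * card M" using ME by simp
  finally have U: "card (\<Union>M) = 2 * card M" .
  have "card G \<le> card (b ` M) + card (g ` (A - \<Union>M))"
    unfolding G_def by (rule card_Un_le)
  also have "\<dots> \<le> card M + card (A - \<Union>M)"
    using M F by (intro add_mono card_image_le) auto
  also have "card (A - \<Union>M) = card A - 2 * card M"
    using UA U F(4) by (simp add: card_Diff_subset finite_subset)
  finally have "card G \<le> card M + (card A - 2 * card M)" .
  moreover have "2 * card M \<le> card A"
    using card_mono[OF F(4) UA] U by simp
  moreover have "t < card G"
  proof (rule no_small_coverD[OF F(1,3)])
    show "G \<subseteq> F - {A}" using b g by (auto simp: G_def)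
    show "finite G" using M F by (auto simp: G_def)
    show "A \<subseteq> \<Union>G" using b g by (fastforce simp: G_def)
  qed
  ultimately show ?thesis by linarith
qed

text \<open>The pairs of \<open>A\<close> that are not own form a graph whose matchings have at most
  \<open>card A - t - 1\<close> edges. Subtracting its Erdos-Gallai bound from the number of all
  pairs cancels \<open>card A choose 2\<close>.\<close>

lemma own_pairs_lower_bound:
  assumes F: "no_small_cover t F" "no_own_point F" "A \<in> F" "finite A" and le: "card A \<le> 2 * t"
  shows "\<exists>r. t + 1 + r \<le> card A \<and>
           ((t + 1 + r) choose 2) \<le> card (own_pairs F A) + ((2 * r + 1) choose 2)"
proof -
  let ?P = "{e. e \<subseteq> A \<and> card e = 2}"
  define k where "k = card A - t - 1"
  define E where "E = ?P - own_pairs F A"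
  \<comment> \<open>The empty matching shows that the subtraction in \<open>k\<close> is not
    truncated.\<close>
  have tA: "t < card A"
    using matching_size_bound[OF F, of "{}"] by simp
  have mf: "matching_free (Suc k) E"
    unfolding matching_free_def
  proof
    assume "\<exists>M\<subseteq>E. card M = Suc k \<and> pairwise disjnt M"
    then obtain M where M: "M \<subseteq> E" "card M = Suc k" "pairwise disjnt M" by blast
    have "finite M" using M(2) card_ge_0_finite[of M] by simp
    moreover have "e \<subseteq> A \<and> card e = 2 \<and> (\<exists>B\<in>F - {A}. e \<subseteq> B)" if "e \<in> M" for e
    proof -
      have "e \<in> E" using that M(1) by blast
      then show ?thesis unfolding E_def own_pairs_def by blast
    qed
    ultimately have "card M + t < card A"
      using M(3) matching_size_bound[OF F] by blast
    then show False using M k_def by simp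
  qed
  \<comment> \<open>This inequality is equivalent to \<open>card A \<le> 2 * t\<close>.\<close>
  have "2 * k + 2 \<le> card A" using le tA by (simp add: k_def)
  from erdos_gallai[OF F(4) _ mf this] obtain r where r: "r \<le> k"
      "card E + ((card A - k + r) choose 2) \<le> (card A choose 2) + ((2 * r + 1) choose 2)"
    by (auto simp: E_def)
  have own: "own_pairs F A \<subseteq> ?P" by (auto simp: own_pairs_def)
  have finP: "finite ?P" using F(4) by simp
  have "card E = card ?P - card (own_pairs F A)"
    unfolding E_def by (intro card_Diff_subset own finite_subset[OF own finP])
  moreover have "card (own_pairs F A) \<le> card ?P" by (intro card_mono own finP)
  moreover have "card ?P = card A choose 2" using F(4) by (simp add: n_subsets)
  moreover have "card A - k + r = t + 1 + r" "t + 1 + r \<le> card A"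
    using tA r by (auto simp: k_def)
  ultimately show ?thesis using r by (intro exI[of _ r]) auto
qed

lemma two_times_choose_two: "2 * real (n choose 2) = real n * (real n - 1)"
  by (induction n) (auto simp: numeral_2_eq_2 algebra_simps)

section \<open>The constant\<close>

definition ratio :: real where
  "ratio = (15 + sqrt 33) / 24"

lemma ratio_root: "12 * ratio\<^sup>2 - 15 * ratio + 4 = 0"
proof -
  have "24 * ratio - 15 = sqrt 33" by (simp add: ratio_def field_simps)
  then have "(24 * ratio - 15)\<^sup>2 = 33" by simp
  then show ?thesis by (simp add: power2_eq_square algebra_simps)
qed

lemma ratio_bounds: "86 / 100 < ratio" "ratio < 87 / 100"
proof -
  have "57 / 10 < sqrt 33" by (rule real_less_rsqrt) (simp add: power2_eq_square)
  moreover have "sqrt 33 < 58 / 10" by (rule real_less_lsqrt) (simp_all add: power2_eq_square)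
  ultimately show "86 / 100 < ratio" "ratio < 87 / 100" by (simp_all add: ratio_def)
qed

text \<open>The right-hand side is concave in \<open>r\<close>, so only the two ends of the range matter.\<close>

lemma own_pairs_quadratic_bound:
  fixes t r :: real
  assumes "2 \<le> t" "0 \<le> r" "r \<le> (2 * ratio - 1) * t - ratio - 1"
  shows "ratio * t\<^sup>2 - 1 \<le> t\<^sup>2 + t + r * (2 * t - 1 - 3 * r)"
proof -
  \<comment> \<open>For a set with fewer than \<open>2 * ratio * t - ratio\<close> points,
    \<open>R\<close> is an upper bound on the \<open>r \<le> card A - t - 1\<close> from
    Erdos-Gallai.\<close>
  define R where "R = (2 * ratio - 1) * t - ratio - 1"
  show ?thesis
  proof (cases "0 \<le> 2 * t - 1 - 3 * R")
    case True
    then have "0 \<le> r * (2 * t - 1 - 3 * r)"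
      using assms by (intro mult_nonneg_nonneg) (auto simp: R_def)
    moreover have "ratio * t\<^sup>2 \<le> 1 * t\<^sup>2"
      using ratio_bounds by (intro mult_right_mono) auto
    ultimately show ?thesis using assms by linarith
  next
    case False
    \<comment> \<open>The product is the value of \<open>r * (2 * t - 1 - 3 * r)\<close> minus its
      value at \<open>R\<close>.\<close>
    have "0 \<le> (R - r) * (3 * (R + r) - (2 * t - 1))"
      using False assms by (intro mult_nonneg_nonneg) (auto simp: R_def)
    then have "R * (2 * t - 1 - 3 * R) \<le> r * (2 * t - 1 - 3 * r)"
      by (simp add: algebra_simps)
    \<comment> \<open>The coefficients of \<open>t\<^sup>2\<close> on the two sides of the desired
      bound agree at \<open>r = R\<close> precisely when \<open>ratio\<close> is a root of
      \<open>12 * x\<^sup>2 - 15 * x + 4\<close>. The remaining linear term is positive from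
      \<open>t = 2\<close> on.\<close>
    moreover have "t\<^sup>2 + t + R * (2 * t - 1 - 3 * R) =
        ratio * t\<^sup>2 - 1 + ((17 * ratio - 10) * t - 35 / 4 * ratio)
        + (t - t\<^sup>2 - 1 / 4) * (12 * ratio\<^sup>2 - 15 * ratio + 4)"
      unfolding R_def by (simp add: power2_eq_square field_simps)
    moreover have "(17 * ratio - 10) * 2 \<le> (17 * ratio - 10) * t"
      using assms ratio_bounds by (intro mult_left_mono) auto
    ultimately show ?thesis using ratio_root ratio_bounds by simp
  qed
qed

section \<open>Counting own pairs to find a large set\<close>

lemma own_pairs_ge:
  assumes F: "no_small_cover t F" "no_own_point F" "A \<in> F" "finite A" and "2 \<le> t"
    and A: "real (card A) < 2 * ratio * real t - ratio"
  shows "ratio * (real t)\<^sup>2 - 1 \<le> 2 * real (card (own_pairs F A))"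
proof -
  have "2 * ratio * real t \<le> 2 * real t"
    using ratio_bounds by (intro mult_right_mono) auto
  then have "card A \<le> 2 * t" using A ratio_bounds by linarith
  from own_pairs_lower_bound[OF F this] obtain r where r: "t + 1 + r \<le> card A"
      "((t + 1 + r) choose 2) \<le> card (own_pairs F A) + ((2 * r + 1) choose 2)" by blast
  then have "2 * real ((t + 1 + r) choose 2) \<le>
      2 * real (card (own_pairs F A)) + 2 * real ((2 * r + 1) choose 2)"
    by linarith
  \<comment> \<open>The left-hand side is twice the difference of the two binomials.\<close>
  then have "(real t)\<^sup>2 + real t + real r * (2 * real t - 1 - 3 * real r) \<le>
      2 * real (card (own_pairs F A))"
    unfolding two_times_choose_two by (simp add: power2_eq_square algebra_simps)
  moreover have "ratio * (real t)\<^sup>2 - 1 \<le>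
      (real t)\<^sup>2 + real t + real r * (2 * real t - 1 - 3 * real r)"
    using r A \<open>2 \<le> t\<close> by (intro own_pairs_quadratic_bound) (auto simp: algebra_simps)
  ultimately show ?thesis by linarith
qed

lemma sum_own_pairs_le:
  assumes "finite X" "F \<subseteq> Pow X"
  shows "(\<Sum>A\<in>F. card (own_pairs F A)) \<le> card X choose 2"
proof -
  have finF: "finite F" using assms by (simp add: finite_subset)
  have sub: "(\<Union>A\<in>F. own_pairs F A) \<subseteq> {e. e \<subseteq> X \<and> card e = 2}"
    using assms(2) by (auto simp: own_pairs_def)
  have finP: "finite {e. e \<subseteq> X \<and> card e = 2}" using assms(1) by simp
  have "(\<Sum>A\<in>F. card (own_pairs F A)) = card (\<Union>A\<in>F. own_pairs F A)"
  proof (rule card_UN_disjoint[symmetric, OF finF])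
    show "\<forall>A\<in>F. finite (own_pairs F A)"
      using sub finP by (meson UN_upper finite_subset)
    show "\<forall>A\<in>F. \<forall>B\<in>F. A \<noteq> B \<longrightarrow> own_pairs F A \<inter> own_pairs F B = {}"
      by (auto simp: own_pairs_def)
  qed
  also have "\<dots> \<le> card {e. e \<subseteq> X \<and> card e = 2}" by (rule card_mono[OF finP sub])
  also have "\<dots> = card X choose 2" using assms(1) by (simp add: n_subsets)
  finally show ?thesis .
qed

text \<open>If all sets were small, each would have more than \<open>(card X - 1) / 2\<close> own
  pairs, and at least \<open>card X\<close> such sets would together own more than
  \<open>card X choose 2\<close> pairs.\<close>

lemma ex_large_set:
  assumes X: "finite X" "F \<subseteq> Pow X" "F \<noteq> {}" and le: "card X \<le> card F"
    and lt: "real (card X) < ratio * (real t)\<^sup>2"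
    and F: "no_small_cover t F" "no_own_point F" "2 \<le> t"
  shows "\<exists>A\<in>F. 2 * ratio * real t - ratio \<le> real (card A)"
proof (rule ccontr)
  assume neg: "\<not> ?thesis"
  have finF: "finite F" using X by (simp add: finite_subset)
  have ne: "0 < card F" using finF X by (simp add: card_gt_0_iff)
  have *: "real (card X) - 1 < 2 * real (card (own_pairs F A))" if "A \<in> F" for A
  proof -
    have "finite A" using that X finite_subset by blast
    then show ?thesis
      using own_pairs_ge[OF F(1,2) that _ F(3)] neg that lt by force
  qed
  \<comment> \<open>This makes the factor \<open>card X - 1\<close> nonnegative, so that
    \<open>card X \<le> card F\<close> may be multiplied by it.\<close>
  have "X \<noteq> {}" using X no_small_cover_nonempty[OF F(1)] by auto
  then have X1: "1 \<le> card X" using X by (simp add: Suc_le_eq card_gt_0_iff)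
  have "real (card X) * (real (card X) - 1) \<le> real (card F) * (real (card X) - 1)"
    using le X1 by (intro mult_right_mono) auto
  also have "\<dots> = (\<Sum>A\<in>F. real (card X) - 1)" by simp
  also have "\<dots> < (\<Sum>A\<in>F. 2 * real (card (own_pairs F A)))"
    using * finF X by (intro sum_strict_mono) auto
  also have "\<dots> = 2 * real (\<Sum>A\<in>F. card (own_pairs F A))" by (simp add: sum_distrib_left)
  also have "\<dots> \<le> 2 * real (card X choose 2)"
    using sum_own_pairs_le[OF X(1,2)] by (simp del: of_nat_sum)
  finally show False by (simp add: two_times_choose_two)
qed

section \<open>Cover-free families with as many sets as points\<close>

text \<open>A cover of the trace \<open>B - A\<close> by \<open>t\<close> other traces becomes a
  cover of \<open>B\<close> by \<open>t + 1\<close> other sets once \<open>A\<close> is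
  added.\<close>

lemma no_small_cover_remove_set:
  assumes F: "no_small_cover (Suc t) F" and A: "A \<in> F"
  shows "no_small_cover t ((\<lambda>B. B - A) ` (F - {A}))"
  unfolding no_small_cover_def
proof (intro ballI allI impI notI)
  fix C G assume C: "C \<in> (\<lambda>B. B - A) ` (F - {A})"
    and G: "G \<subseteq> (\<lambda>B. B - A) ` (F - {A}) - {C}" "finite G" "card G \<le> t" "C \<subseteq> \<Union>G"
  from C obtain B where B: "B \<in> F - {A}" "C = B - A" by blast
  \<comment> \<open>Different sets may have equal traces; choosing one set per trace gives
    \<open>card H = card G\<close>.\<close>
  from G(1) have "G \<subseteq> (\<lambda>B. B - A) ` (F - {A})" by blast
  then obtain H where H: "H \<subseteq> F - {A}" "inj_on (\<lambda>B. B - A) H" "G = (\<lambda>B. B - A) ` H"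
    unfolding subset_image_inj by blast
  have card: "card H \<le> t" "finite H"
    using G(2,3) H(2,3) by (auto simp: card_image finite_image_iff)
  have "B \<notin> H" using G H B by blast
  then have "insert A H \<subseteq> F - {B}" using H A B by auto
  moreover have "B \<subseteq> \<Union>(insert A H)" using G(4) B H by auto
  ultimately have "Suc t < card (insert A H)"
    using no_small_coverD[OF F, of B "insert A H"] B card by auto
  then show False using card by (simp add: card_insert_if split: if_splits)
qed

text \<open>If \<open>B\<close> and \<open>C\<close> agree outside \<open>A\<close>, the two sets
  \<open>A\<close> and \<open>C\<close> cover \<open>B\<close>.\<close>

lemma inj_on_remove_set:
  assumes F: "no_small_cover t F" "2 \<le> t" and A: "A \<in> F"
  shows "inj_on (\<lambda>B. B - A) (F - {A})"
proof (rule inj_onI, rule ccontr)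
  fix B C assume BC: "B \<in> F - {A}" "C \<in> F - {A}" "B - A = C - A" "B \<noteq> C"
  then have "t < card {A, C}"
    using A by (intro no_small_coverD[OF F(1), of B]) auto
  moreover have "card {A, C} \<le> 2" by (simp add: card_insert_if)
  ultimately show False using F(2) by simp
qed

text \<open>The induction on \<open>t\<close> serves the removal of a large set, the inner one on
  \<open>card F\<close> the removal of a set with an own point. An inequality between
  \<open>card X\<close> and \<open>card F\<close> is assumed because a large set takes away more
  points than sets.\<close>

lemma no_small_cover_singletons:
  assumes "finite X" "F \<subseteq> Pow X" "no_small_cover t F" "card X \<le> card F"
    and "real (card X) < ratio * (real t)\<^sup>2"
  shows "F = (\<lambda>x. {x}) ` X"
  using assms
proof (induction t arbitrary: F X)
  case 0
  then show ?case by simp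
next
  case (Suc t)
  note IH = Suc.IH
  from Suc.prems show ?case
  proof (induction "card F" arbitrary: F X rule: less_induct)
    case less
    note X = less.prems(1,2) and F = less.prems(3) and le = less.prems(4) and lt = less.prems(5)
    have finF: "finite F" using X by (simp add: finite_subset)
    consider "F = {}" | "F \<noteq> {}" "\<not> no_own_point F" | "F \<noteq> {}" "no_own_point F" by blast
    then show ?case
    proof cases
      case 1
      then show ?thesis using le X by simp
    next
      case 2
      then obtain A x where A: "A \<in> F" "x \<in> A" "\<And>B. B \<in> F - {A} \<Longrightarrow> x \<notin> B"
        unfolding no_own_point_def by blast
      have xX: "x \<in> X" using A X by blast
      have rest: "F - {A} = (\<lambda>x. {x}) ` (X - {x})"
      proof (rule less.hyps)
        show "card (F - {A}) < card F" using A finF by (intro psubset_card_mono) auto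
        show "finite (X - {x})" using X by simp
        show "F - {A} \<subseteq> Pow (X - {x})" using A X by blast
        show "no_small_cover (Suc t) (F - {A})"
          using F by (rule no_small_cover_subset) auto
        show "card (X - {x}) \<le> card (F - {A})" using le A xX by simp
        have "real (card (X - {x})) \<le> real (card X)" using X by (simp add: card_mono)
        then show "real (card (X - {x})) < ratio * (real (Suc t))\<^sup>2" using lt by linarith
      qed
      \<comment> \<open>For a further point \<open>y\<close> of \<open>A\<close> the rest contains
        \<open>{y}\<close>, which \<open>A\<close> alone covers.\<close>
      have "A \<subseteq> {x}"
      proof (rule ccontr)
        assume "\<not> A \<subseteq> {x}"
        then obtain y where y: "y \<in> A" "y \<noteq> x" by blast
        then have "y \<in> X - {x}" using A X by blast
        then have "{y} \<in> F - {A}" unfolding rest by blast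
        then have "Suc t < card {A}" using A y by (intro no_small_coverD[OF F, of "{y}"]) auto
        then show False by simp
      qed
      then have "A = {x}" using A by blast
      then have "F = insert {x} ((\<lambda>x. {x}) ` (X - {x}))" using rest A by blast
      then show ?thesis using xX by blast
    next
      case 3
      have "X \<noteq> {}" using X 3 no_small_cover_nonempty[OF F] by auto
      then have "1 \<le> card X" using X by (simp add: Suc_le_eq card_gt_0_iff)
      \<comment> \<open>For \<open>t = 0\<close> the bound would read \<open>card X < ratio\<close>,
        which is below 1.\<close>
      then have t: "1 \<le> t" using lt ratio_bounds by (cases t) auto
      obtain A where A: "A \<in> F" "2 * ratio * real (Suc t) - ratio \<le> real (card A)"
        using ex_large_set[OF X 3(1) le lt F 3(2)] t by auto
      let ?F = "(\<lambda>B. B - A) ` (F - {A})"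
      have AX: "A \<subseteq> X" using A X by blast
      have cX: "card (X - A) = card X - card A" "card A \<le> card X"
        using AX X by (auto simp: card_Diff_subset finite_subset card_mono)
      have cF: "card ?F = card F - 1"
        using inj_on_remove_set[OF F _ A(1)] t A finF by (simp add: card_image)
      \<comment> \<open>The size of \<open>A\<close> is at least \<open>3 * ratio > 2\<close>, so
        more points than sets disappear, even strictly.\<close>
      have "2 * ratio * 2 \<le> 2 * ratio * real (Suc t)"
        using t ratio_bounds by (intro mult_left_mono) auto
      then have "2 < card A" using A ratio_bounds by linarith
      then have less: "card (X - A) < card ?F" using cX cF le by linarith
      have "?F = (\<lambda>x. {x}) ` (X - A)"
      proof (rule IH)
        show "finite (X - A)" using X by simp
        show "?F \<subseteq> Pow (X - A)" using X by blast
        show "no_small_cover t ?F" using F A(1) by (rule no_small_cover_remove_set)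
        show "card (X - A) \<le> card ?F" using less by simp
        \<comment> \<open>The threshold for large sets is exactly the difference between
          \<open>ratio * (t + 1)\<^sup>2\<close> and \<open>ratio * t\<^sup>2\<close>.\<close>
        have "real (card (X - A)) = real (card X) - real (card A)" using cX by simp
        also have "\<dots> < ratio * (real (Suc t))\<^sup>2 - (2 * ratio * real (Suc t) - ratio)"
          using lt A by linarith
        also have "\<dots> = ratio * (real t)\<^sup>2" by (simp add: power2_eq_square algebra_simps)
        finally show "real (card (X - A)) < ratio * (real t)\<^sup>2" .
      qed
      \<comment> \<open>Contradiction: there are fewer singletons than members of the reduced
        family.\<close>
      then have "card ?F \<le> card (X - A)" using X by (metis card_image_le finite_Diff)
      with less show ?thesis by simp
    qed
  qed
qed

section \<open>Cover-free families and matrices as in the statement\<close>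

lemma cover_freeD:
  assumes cf: "cover_free t F" and A: "A \<in> F" and G: "G \<subseteq> F - {A}" "finite G" "G \<noteq> {}"
    and le: "card G \<le> t"
  shows "\<not> A \<subseteq> \<Union>G"
proof -
  define r where "r = card G"
  obtain h where h: "bij_betw h {1..r} G"
    using ex_bij_betw_nat_finite_1[OF G(2)] by (auto simp: r_def)
  define B where "B i = (if i = 0 then A else h i)" for i
  have r: "r \<in> {1..t}" using G le by (auto simp: r_def Suc_le_eq card_gt_0_iff)
  have split: "{0..r} = insert 0 {1..r}" by auto
  have img: "B ` {1..r} = G"
    using h by (auto simp: B_def bij_betw_def image_iff)
  have "inj_on B {1..r} \<longleftrightarrow> inj_on h {1..r}" by (intro inj_on_cong) (auto simp: B_def)
  then have "inj_on B {1..r}" using h by (simp add: bij_betw_def)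
  moreover have "B 0 \<notin> B ` {1..r}" unfolding img using G by (auto simp: B_def)
  ultimately have "inj_on B {0..r}" unfolding split by (subst inj_on_insert) auto
  moreover have "B ` {0..r} \<subseteq> F" unfolding split using img G A by (auto simp: B_def)
  ultimately have "\<not> B 0 \<subseteq> (\<Union>i\<in>{1..r}. B i)"
    using cf r unfolding cover_free_def by blast
  then show ?thesis using img by (simp add: B_def)
qed

lemma cover_free_imp_no_small_cover:
  assumes cf: "cover_free t F" and t: "0 < t" and F: "1 < card F"
  shows "no_small_cover t F"
  unfolding no_small_cover_def
proof (intro ballI allI impI)
  fix A G assume A: "A \<in> F" and G: "G \<subseteq> F - {A}" "finite G" "card G \<le> t"
  have "\<exists>B. B \<in> F - {A}"
  proof (rule ccontr)
    assume "\<nexists>B. B \<in> F - {A}"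
    then have "F \<subseteq> {A}" by blast
    then have "card F \<le> card {A}" by (intro card_mono) auto
    with F show False by simp
  qed
  then obtain B where B: "B \<in> F - {A}" by blast
  show "\<not> A \<subseteq> \<Union>G"
  proof (cases "G = {}")
    \<comment> \<open>An empty \<open>A\<close> would lie inside the single other member
      \<open>B\<close>, contrary to the case \<open>r = 1\<close>.\<close>
    case True
    have "\<not> A \<subseteq> \<Union>{B}" using B t by (intro cover_freeD[OF cf A]) auto
    then show ?thesis using True by auto
  qed (use cover_freeD[OF cf A G(1,2) _ G(3)] in blast)
qed

lemma cover_free_singletons:
  assumes "t > 0" "1 < n" "real n < (15 + sqrt 33) / 24 * (real t)\<^sup>2"
    and "F \<subseteq> Pow {1..n}" "cover_free t F" "card F = n"
  shows "F = (\<lambda>i. {i}) ` {1..n}"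
proof (rule no_small_cover_singletons)
  show "no_small_cover t F" using assms cover_free_imp_no_small_cover by blast
  show "real (card {1..n}) < ratio * (real t)\<^sup>2" using assms(3) unfolding ratio_def by simp
qed (use assms in simp_all)

text \<open>Columns hold one 1 because every \<open>F (Suc j)\<close> is a singleton. Rows hold at
  least one because every singleton is reached, and at most one because \<open>F\<close> is
  injective.\<close>

lemma permutation_incidence_mat:
  assumes inj: "inj_on F {1..n}" and F: "F ` {1..n} = (\<lambda>i. {i}) ` {1..n}"
  shows "permutation_mat (incidence_mat n n F)"
proof -
  let ?M = "incidence_mat n n F"
  have M: "?M $$ (i, j) = (if Suc i \<in> F (Suc j) then 1 else 0)" if "i < n" "j < n" for i j
    using that by (simp add: incidence_mat_def)
  have dim: "dim_row ?M = n" "dim_col ?M = n" by (simp_all add: incidence_mat_def)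
  have M1: "?M $$ (i, j) = 1 \<longleftrightarrow> Suc i \<in> F (Suc j)" if "i < n" "j < n" for i j
    unfolding M[OF that] by simp
  have sing: "\<exists>u<n. F (Suc j) = {Suc u}" if "j < n" for j
  proof -
    have "F (Suc j) \<in> (\<lambda>i. {i}) ` {1..n}" unfolding F[symmetric] using that by auto
    then obtain u where u: "u \<in> {1..n}" "F (Suc j) = {u}" by blast
    then show ?thesis by (cases u) auto
  qed
  have row: "\<exists>!j. j < n \<and> ?M $$ (i, j) = 1" if i: "i < n" for i
  proof -
    have "{Suc i} \<in> F ` {1..n}" unfolding F using i by auto
    then obtain v where v: "v \<in> {1..n}" "{Suc i} = F v" by (rule imageE)
    then obtain k where k: "v = Suc k" "k < n" by (cases v) auto
    show ?thesis
    proof (rule ex1I)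
      show "k < n \<and> ?M $$ (i, k) = 1" using M1[OF i k(2)] v(2) k by blast
      fix j assume j: "j < n \<and> ?M $$ (i, j) = 1"
      then have "Suc i \<in> F (Suc j)" using M1[OF i] by blast
      then have "F (Suc j) = F (Suc k)" using sing[of j] j v(2) k(1) by auto
      then show "j = k" using inj_onD[OF inj, of "Suc j" "Suc k"] j k(2) by simp
    qed
  qed
  have col: "\<exists>!i. i < n \<and> ?M $$ (i, j) = 1" if j: "j < n" for j
  proof -
    obtain u where u: "u < n" "F (Suc j) = {Suc u}" using sing[OF j] by blast
    show ?thesis
    proof (rule ex1I)
      show "u < n \<and> ?M $$ (u, j) = 1" using M1[OF u(1) j] u by blast
      fix i assume "i < n \<and> ?M $$ (i, j) = 1"
      then have "Suc i \<in> F (Suc j)" using M1[OF _ j] by blast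
      then show "i = u" by (simp add: u(2))
    qed
  qed
  have "\<forall>i<n. \<forall>j<n. ?M $$ (i, j) \<in> {0, 1}" by (simp add: M)
  then show ?thesis
    unfolding permutation_mat_def square_mat.simps dim using row col by blast
qed

theorem theorem5p2:
  fixes t n :: nat
  assumes "t > 0"
    and "1 < n"
    and "real n < (15 + sqrt 33) / 24 * (real t)\<^sup>2"
  shows "(\<forall>M \<in> carrier_mat n n. disjunct_mat t M \<longrightarrow> permutation_mat M) \<and>
         (\<forall>\<F> \<subseteq> Pow {1..n}. cover_free t \<F> \<and> card \<F> = n \<longrightarrow> \<F> = (\<lambda>i. {i}) ` {1..n})"
proof (intro conjI ballI allI impI)
  fix M :: "int mat" assume M: "M \<in> carrier_mat n n" "disjunct_mat t M"
  then obtain F where F: "inj_on F {1..n}" "F ` {1..n} \<subseteq> Pow {1..n}"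
      "cover_free t (F ` {1..n})" "M = incidence_mat n n F"
    unfolding disjunct_mat_def by auto
  have "F ` {1..n} = (\<lambda>i. {i}) ` {1..n}"
    using F by (intro cover_free_singletons[OF assms]) (simp_all add: card_image)
  then show "permutation_mat M" using permutation_incidence_mat[OF F(1)] F(4) by simp
next
  fix \<F> :: "nat set set" assume "\<F> \<subseteq> Pow {1..n}" "cover_free t \<F> \<and> card \<F> = n"
  then show "\<F> = (\<lambda>i. {i}) ` {1..n}" using cover_free_singletons[OF assms] by blast
qed

end
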